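(* Let $G$ be a connected graph with $n$ vertices and minimum degree $k$. Then there exists a connected subgraph $H$ of $G$ with at most $3\lfloor n/(k+1)\rfloor-2$ vertices such that every vertex of $G$ is at distance at most $2$ (in $G$) from $H$.
   Context: Graphs are finite, simple, undirected and have at least one vertex; a connected subgraph is understood to be nonempty. The distance in $G$ from a vertex $v$ to a subgraph $H$ is the minimum, over vertices $u$ of $H$, of the graph distance in $G$ between $v$ and $u$. *)

theory Defs
  imports "Graph_Theory.Graph_Theory"
begin

(* Finite simple undirected graphs are the locale graph of Graph_Theory: finite symmetric
   digraphs without loops or parallel arcs. An undirected edge is a pair of opposite arcs, so
   the degree of a vertex is its out-degree. The locale admits the graph without vertices;
   connected (in the sense of Graph_Theory) excludes it. *)

definition min_degree :: "('a, 'b) pre_digraph \<Rightarrow> nat" where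
  "min_degree G = (MIN v \<in> verts G. out_degree G v)"

(* With unit arc weights, \<mu> is the minimal number of arcs on a walk, and infinity if
   there is no walk. *)
definition graph_dist :: "('a, 'b) pre_digraph \<Rightarrow> 'a \<Rightarrow> 'a \<Rightarrow> ereal" where
  "graph_dist G u v = wf_digraph.\<mu> G (\<lambda>_. 1) u v"

(* Distances are measured in the ambient graph G, not in H. The minimum is meaningful only
   if H has finitely many vertices and at least one. *)
definition dist_to_subgraph ::
    "('a, 'b) pre_digraph \<Rightarrow> 'a \<Rightarrow> ('a, 'b) pre_digraph \<Rightarrow> ereal" where
  "dist_to_subgraph G v H = (MIN u \<in> verts H. graph_dist G v u)"

end

(* Grow a connected vertex set W together with a set S \<subseteq> W of centres whose closed
   neighbourhoods are pairwise disjoint, keeping |W| \<le> 3|S| - 2. Start with W = S = {v}.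
   If some vertex is at distance more than 2 from W, then by connectedness there is a path
   w, a, x, y leaving W whose end y is at distance exactly 3 from W; add a, x, y to W and y
   to S. The closed neighbourhoods of S are disjoint and have at least k + 1 vertices each, so
   |S| \<le> n/(k+1); hence the process stops, and then W is within distance 2 of every vertex. *)

theory Submission
  imports Defs
begin

definition closed_nbhd :: "('a, 'b) pre_digraph \<Rightarrow> 'a \<Rightarrow> 'a set" where
  "closed_nbhd G v = insert v {u. v \<rightarrow>\<^bsub>G\<^esub> u}"

text \<open>For \<open>W\<close> inside \<open>verts G\<close>, these are the vertices at distance
  at most 2 from \<open>W\<close>; closed neighbourhoods at both steps admit the distances 0 and 1.
  The growth argument thereby avoids extended reals.\<close>

definition second_nbhd :: "('a, 'b) pre_digraph \<Rightarrow> 'a set \<Rightarrow> 'a set" where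
  "second_nbhd G W = (\<Union>w\<in>W. \<Union>a\<in>closed_nbhd G w. closed_nbhd G a)"

lemma self_in_closed_nbhd [simp]: "v \<in> closed_nbhd G v"
  by (simp add: closed_nbhd_def)

lemma subset_second_nbhd: "W \<subseteq> second_nbhd G W"
  unfolding second_nbhd_def using self_in_closed_nbhd by fast

lemma (in sym_digraph) dominates_sym: "u \<rightarrow> v \<Longrightarrow> v \<rightarrow> u"
  using arcs_ends_symmetric[OF sym_arcs] .

lemma (in sym_digraph) closed_nbhd_sym: "u \<in> closed_nbhd G v \<longleftrightarrow> v \<in> closed_nbhd G u"
  by (auto simp: closed_nbhd_def dominates_sym)

lemma (in wf_digraph) closed_nbhd_subset_verts:
  "v \<in> verts G \<Longrightarrow> closed_nbhd G v \<subseteq> verts G"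
  by (auto simp: closed_nbhd_def adj_in_verts)

text \<open>Without parallel arcs, out-arcs correspond to neighbours; without loops,
  \<open>v\<close> itself adds one more.\<close>

lemma (in digraph) card_closed_nbhd: "card (closed_nbhd G v) = Suc (out_degree G v)"
proof -
  have "{u. v \<rightarrow> u} = head G ` out_arcs G v"
    by (auto simp: arcs_ends_conv)
  moreover have "inj_on (head G) (out_arcs G v)"
    by (rule inj_onI) (auto intro: no_multi_arcs simp: arc_to_ends_def)
  ultimately have "card {u. v \<rightarrow> u} = out_degree G v" "finite {u. v \<rightarrow> u}"
    by (auto simp: card_image out_degree_def)
  moreover have "v \<notin> {u. v \<rightarrow> u}"
    using adj_not_same by auto
  ultimately show ?thesis
    by (simp add: closed_nbhd_def)
qed

lemma (in digraph) card_mult_le_of_disjoint_closed_nbhds: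
  assumes "S \<subseteq> verts G" and "disjoint_family_on (closed_nbhd G) S"
  shows "card S * Suc (min_degree G) \<le> card (verts G)"
proof -
  have "finite S"
    using assms(1) finite_verts by (rule finite_subset)
  \<comment> \<open>An infinite set has \<open>card\<close> 0, so a successor value proves
    finiteness.\<close>
  have fin: "finite (closed_nbhd G v)" for v
    using card_closed_nbhd[of v] by (intro card_ge_0_finite) simp
  have "card S * Suc (min_degree G) = (\<Sum>v\<in>S. Suc (min_degree G))"
    by simp
  also have "\<dots> \<le> (\<Sum>v\<in>S. card (closed_nbhd G v))"
    using assms(1) by (intro sum_mono) (auto simp: card_closed_nbhd min_degree_def)
  also have "\<dots> = card (\<Union>v\<in>S. closed_nbhd G v)"
    using assms(2) \<open>finite S\<close> fin
    by (intro card_UN_disjoint[symmetric]) (auto simp: disjoint_family_on_def)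
  also have "\<dots> \<le> card (verts G)"
    using assms(1) closed_nbhd_subset_verts by (intro card_mono) auto
  finally show ?thesis .
qed

text \<open>All connections can be routed through \<open>w\<close>; symmetry supplies the arc back
  from \<open>a\<close>.\<close>

lemma (in graph) strongly_connected_induce_insert:
  assumes sc: "strongly_connected (G \<restriction> W)" and "w \<in> W" and "w \<rightarrow> a"
  shows "strongly_connected (G \<restriction> (insert a W))"
proof -
  let ?W = "insert a W"
  interpret I: wf_digraph "G \<restriction> ?W" by auto
  have W: "u \<rightarrow>\<^sup>*\<^bsub>G \<restriction> ?W\<^esub> v" if "u \<in> W" "v \<in> W" for u v
  proof (rule reachable_induce_ss)
    show "u \<rightarrow>\<^sup>*\<^bsub>G \<restriction> W\<^esub> v"
      using sc that by (simp add: strongly_connected_def)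
  qed auto
  have "w \<rightarrow>\<^bsub>G \<restriction> ?W\<^esub> a" and "a \<rightarrow>\<^bsub>G \<restriction> ?W\<^esub> w"
    using assms(2,3) dominates_sym[OF assms(3)] by (auto simp: arcs_ends_conv)
  then have wa: "w \<rightarrow>\<^sup>*\<^bsub>G \<restriction> ?W\<^esub> a" and aw: "a \<rightarrow>\<^sup>*\<^bsub>G \<restriction> ?W\<^esub> w"
    by auto
  have to_w: "u \<rightarrow>\<^sup>*\<^bsub>G \<restriction> ?W\<^esub> w" and of_w: "w \<rightarrow>\<^sup>*\<^bsub>G \<restriction> ?W\<^esub> u" if "u \<in> ?W" for u
    using that W \<open>w \<in> W\<close> wa aw by auto
  show ?thesis
    using I.reachable_trans[OF to_w of_w] by (intro strongly_connectedI) auto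
qed

lemma (in wf_digraph) reachable_leaves_set:
  assumes "u \<rightarrow>\<^sup>* v" and "u \<in> A" and "v \<notin> A"
  obtains x y where "x \<in> A" "y \<notin> A" "x \<rightarrow> y"
  using assms by (induct rule: converse_reachable_induct) auto

text \<open>Passage from neighbourhoods to the metric: a walk \<open>v\<close>, \<open>a\<close>,
  \<open>w\<close> bounds the distance by its length.\<close>

lemma (in sym_digraph) dist_le_2_of_second_nbhd:
  assumes "verts H \<subseteq> verts G" and "finite (verts H)" and "v \<in> second_nbhd G (verts H)"
  shows "dist_to_subgraph G v H \<le> 2"
proof -
  obtain w a where w: "w \<in> verts H" and "a \<in> closed_nbhd G w" "v \<in> closed_nbhd G a"
    using assms(3) by (auto simp: second_nbhd_def)
  then have va: "v = a \<or> v \<rightarrow> a" and aw: "a = w \<or> a \<rightarrow> w"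
    by (auto simp: closed_nbhd_def dominates_sym)
  have "w \<in> verts G"
    using w assms(1) by auto
  \<comment> \<open>Each of the two steps of the walk uses one arc or, if its ends coincide,
    none.\<close>
  then obtain p where p: "awalk a p w" "length p \<le> 1"
  proof -
    consider "awalk a [] w" | e where "awalk a [e] w"
      using aw \<open>w \<in> verts G\<close> by (auto simp: awalk_simps arcs_ends_conv)
    then show thesis
      using that by cases auto
  qed
  obtain q where q: "awalk v q w" "length q \<le> 2"
  proof -
    consider "awalk v p w" | e where "awalk v (e # p) w"
      using va p by (auto simp: awalk_simps arcs_ends_conv)
    then show thesis
      using that p by cases auto
  qed
  have "dist_to_subgraph G v H \<le> \<mu> (\<lambda>_. 1) v w"
    using w assms(2) unfolding dist_to_subgraph_def graph_dist_def by (intro Min_le) auto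
  also have "\<dots> \<le> ereal (awalk_cost (\<lambda>_. 1) q)"
    using q(1) by (rule min_cost_le_walk_cost)
  also have "awalk_cost (\<lambda>_. 1) q = real (length q)"
    by (simp add: awalk_cost_def sum_list_triv)
  also have "ereal (real (length q)) \<le> 2"
    using q(2) by simp
  finally show ?thesis .
qed

text \<open>The invariant of the growth. The inequality is |W| \<le> 3|S| - 2 without truncated
  subtraction; it also forces \<open>S\<close> to be nonempty.\<close>

definition centred_set :: "('a, 'b) pre_digraph \<Rightarrow> 'a set \<Rightarrow> 'a set \<Rightarrow> bool" where
  "centred_set G W S \<longleftrightarrow> S \<subseteq> W \<and> W \<subseteq> verts G \<and> strongly_connected (G \<restriction> W) \<and>
     card W + 2 \<le> 3 * card S \<and> disjoint_family_on (closed_nbhd G) S"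

text \<open>At most three vertices join \<open>W\<close> and exactly one joins \<open>S\<close>,
  which preserves the size bound.\<close>

lemma (in graph) centred_set_extend:
  assumes WS: "centred_set G W S" and sc: "strongly_connected G"
    and v: "v \<in> verts G" "v \<notin> second_nbhd G W"
  obtains W' S' where "centred_set G W' S'" "card S < card S'"
proof -
  have sub: "S \<subseteq> W" "W \<subseteq> verts G" and con: "strongly_connected (G \<restriction> W)"
    and card: "card W + 2 \<le> 3 * card S" and disj: "disjoint_family_on (closed_nbhd G) S"
    using WS by (auto simp: centred_set_def)
  have fin: "finite W" "finite S"
    by (meson sub finite_verts finite_subset)+
  obtain u where "u \<in> W"
    using con by (auto simp: strongly_connected_def)
  then have "u \<rightarrow>\<^sup>* v" "u \<in> second_nbhd G W"
    using sc v sub subset_second_nbhd[of W G] by (auto simp: strongly_connected_def)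
  \<comment> \<open>A walk from \<open>W\<close> to \<open>v\<close> must leave the second
    neighbourhood; the first vertex \<open>y\<close> outside becomes the new centre.\<close>
  then obtain x y where x: "x \<in> second_nbhd G W" and y: "y \<notin> second_nbhd G W" and xy: "x \<rightarrow> y"
    using v(2) by (rule reachable_leaves_set)
  obtain w a where w: "w \<in> W" and a: "a \<in> closed_nbhd G w" and xa: "x \<in> closed_nbhd G a"
    using x by (auto simp: second_nbhd_def)
  \<comment> \<open>If \<open>x = a\<close> or \<open>a = w\<close>, then \<open>y\<close> would be
    at most two steps from \<open>w\<close>. So \<open>w\<close>, \<open>a\<close>,
    \<open>x\<close>, \<open>y\<close> are joined by genuine arcs.\<close>
  have "y \<notin> closed_nbhd G a"
    using y w a by (auto simp: second_nbhd_def)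
  then have "x \<noteq> a"
    using xy by (auto simp: closed_nbhd_def)
  then have ax: "a \<rightarrow> x"
    using xa by (auto simp: closed_nbhd_def)
  have "y \<notin> closed_nbhd G x" if "a = w"
    using that y w xa by (auto simp: second_nbhd_def)
  then have wa: "w \<rightarrow> a"
    using a xy by (auto simp: closed_nbhd_def)
  define W' where "W' = insert y (insert x (insert a W))"
  \<comment> \<open>The vertices are attached one at a time along the path: \<open>a\<close> to
    \<open>w\<close>, \<open>x\<close> to \<open>a\<close>, \<open>y\<close> to
    \<open>x\<close>.\<close>
  have "strongly_connected (G \<restriction> W')"
    unfolding W'_def using con w wa ax xy
    by (intro strongly_connected_induce_insert[of "insert x (insert a W)" x]
        strongly_connected_induce_insert[of "insert a W" a]
        strongly_connected_induce_insert[of W w]) auto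
  moreover have "W' \<subseteq> verts G"
    using sub xy ax by (auto simp: W'_def adj_in_verts)
  moreover have "y \<notin> S"
    using y sub subset_second_nbhd[of W G] by auto
  then have "card (insert y S) = Suc (card S)"
    using fin by simp
  moreover have "card W' \<le> card W + 3"
    using fin by (simp add: W'_def card_insert_if)
  moreover have "closed_nbhd G y \<inter> closed_nbhd G s = {}" if "s \<in> S" for s
  proof -
    \<comment> \<open>A common vertex \<open>b\<close> of both neighbourhoods would lead from
      \<open>s\<close>, which lies in \<open>W\<close>, to \<open>y\<close> in two steps.\<close>
    have "y \<notin> closed_nbhd G b" if "b \<in> closed_nbhd G s" for b
      using y that \<open>s \<in> S\<close> sub by (auto simp: second_nbhd_def)
    then show ?thesis
      using closed_nbhd_sym[of y] by blast
  qed
  then have "disjoint_family_on (closed_nbhd G) (insert y S)"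
    using disj \<open>y \<notin> S\<close> by (subst disjoint_family_on_insert) auto
  ultimately have "centred_set G W' (insert y S)" "card S < card (insert y S)"
    using sub card by (auto simp: centred_set_def W'_def)
  then show thesis
    by (rule that)
qed

text \<open>The growth process becomes an extremal choice: when \<open>card S\<close> is maximal, an
  uncovered vertex would contradict \<open>centred_set_extend\<close>.\<close>

lemma (in graph) ex_centred_set_covering:
  assumes sc: "strongly_connected G"
  obtains W S where "centred_set G W S" "verts G \<subseteq> second_nbhd G W"
proof -
  obtain v where "v \<in> verts G"
    using sc by (auto simp: strongly_connected_def)
  moreover have "reachable (G \<restriction> {v}) v v"
    by (simp add: reachable_def)
  \<comment> \<open>The start meets the size bound with equality: 1 + 2 = 3.\<close>
  ultimately have "centred_set G {v} {v}"
    by (auto simp: centred_set_def disjoint_family_on_def strongly_connected_def)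
  then have ex: "\<exists>W. centred_set G W {v}"
    by blast
  \<comment> \<open>Only \<open>card S\<close> is maximised, so \<open>W\<close> sits under an
    existential quantifier; the maximum exists because \<open>S\<close> lies in
    \<open>verts G\<close>.\<close>
  have "\<forall>S. (\<exists>W. centred_set G W S) \<longrightarrow> card S < Suc (card (verts G))"
    by (auto simp: centred_set_def less_Suc_eq_le intro!: card_mono)
  from ex_has_greatest_nat[of "\<lambda>S. \<exists>W. centred_set G W S", OF ex this]
  obtain W S where WS: "centred_set G W S"
    and max: "\<And>W' S'. centred_set G W' S' \<Longrightarrow> card S' \<le> card S"
    by blast
  have "v \<in> second_nbhd G W" if "v \<in> verts G" for v
  proof (rule ccontr)
    assume "v \<notin> second_nbhd G W"
    with WS sc that obtain W' S' where "centred_set G W' S'" "card S < card S'"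
      by (rule centred_set_extend)
    with max show False
      by (simp add: leD)
  qed
  then have "verts G \<subseteq> second_nbhd G W"
    by (rule subsetI)
  with WS show thesis
    by (rule that)
qed

theorem lemma1p2:
  fixes G :: "('a, 'b) pre_digraph" and n k :: nat
  assumes "graph G"
    and "connected G"
    and "card (verts G) = n"
    and "min_degree G = k"
  shows "\<exists>H. graph H \<and> subgraph H G \<and> connected H \<and>
           int (card (verts H)) \<le> 3 * \<lfloor>real n / real (k + 1)\<rfloor> - 2 \<and>
           (\<forall>v \<in> verts G. dist_to_subgraph G v H \<le> 2)"
proof -
  interpret graph G by fact
  have "strongly_connected G"
    \<comment> \<open>\<open>connected\<close> ignores arc directions, but symmetry of the arcs
      makes every connection a directed one.\<close>
    using sym_arcs assms(2) by (rule symmetric_connected_imp_strongly_connected)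
  then obtain W S where WS: "centred_set G W S" and cover: "verts G \<subseteq> second_nbhd G W"
    by (rule ex_centred_set_covering)
  have sub: "S \<subseteq> verts G" "W \<subseteq> verts G" and sc: "strongly_connected (G \<restriction> W)"
    and card: "card W + 2 \<le> 3 * card S" and disj: "disjoint_family_on (closed_nbhd G) S"
    using WS by (auto simp: centred_set_def)
  let ?H = "G \<restriction> W"
  have ind: "induced_subgraph ?H G"
    using sub by auto
  interpret H: digraph ?H
    using ind by (rule digraphI_induced)
  have "graph ?H"
    using ind sym_arcs by (intro H.graphI) (rule induced_graph_imp_symmetric)
  moreover have "connected ?H"
    using sc by (intro H.connectedI H.reachable_mk_symmetricI) (auto simp: strongly_connected_def)
  \<comment> \<open>Disjointness gives |S|(k + 1) \<le> n, and as |S| is an integer it is bounded by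
    the rounded quotient.\<close>
  moreover have "card S \<le> n div (k + 1)"
    using card_mult_le_of_disjoint_closed_nbhds[OF sub(1) disj] assms(3,4)
    by (simp add: less_eq_div_iff_mult_less_eq)
  \<comment> \<open>The floor of the real quotient is \<open>n div (k + 1)\<close>; over
    \<open>int\<close> the subtraction of 2 is exact.\<close>
  then have "int (card (verts ?H)) \<le> 3 * \<lfloor>real n / real (k + 1)\<rfloor> - 2"
    using card unfolding floor_divide_of_nat_eq by simp
  moreover have "\<forall>v \<in> verts G. dist_to_subgraph G v ?H \<le> 2"
    using cover sub H.finite_verts by (intro ballI dist_le_2_of_second_nbhd) auto
  moreover have "subgraph ?H G"
    using sub(2) by (rule subgraph_induce_subgraphI)
  ultimately show ?thesis
    by blast
qed

end
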